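(* Let $r\in\,]0,1[$ and let $\mathfrak{A}_\infty$ be the limiting velocity matrix of a system undergoing a triangular collapse, with limiting unit vectors $\omega_{1,\infty},\omega_{2,\infty},\omega_{3,\infty}\in\mathbb{R}^d$. Let $F=\mathrm{span}(\omega_{1,\infty},\omega_{2,\infty})\times\mathrm{span}(\omega_{1,\infty},\omega_{2,\infty})\subset\mathbb{R}^d\times\mathbb{R}^d$ and let $\overline{\mathfrak{A}}_\infty$ be the restriction of $\mathfrak{A}_\infty$ to $F$. Then: 1. $\mathfrak{A}_\infty(F)\subset F$, and in the basis $(\omega_{1,\infty},0),(\omega_{1,\infty}^\perp,0),(0,\omega_{2,\infty}),(0,\omega_{2,\infty}^\perp)$ of $F$ one has $$\overline{\mathfrak{A}}_\infty=\begin{pmatrix} \frac{-r^3+5r^2-59r-1}{64} & \frac{\sqrt3(r+1)}{8} & \frac{r^2-4r-5}{16} & -\frac{\sqrt3(r+1)}{8}\\ \frac{\sqrt3(r^3+3r^2+11r+9)}{64} & \frac{5-3r}{8} & -\frac{\sqrt3(r^2+4r+3)}{16} & \frac{3r+3}{8}\\ \frac{-r^3+17r^2+13r-5}{64} & \frac{\sqrt3(r+1)}{8} & \frac{r^2-16r-1}{16} & -\frac{\sqrt3(r+1)}{8}\\ \frac{\sqrt3(-r^3+r^2+13r+11)}{64} & \frac{3r+3}{8} & \frac{\sqrt3(r^2-1)}{16} & \frac{5-3r}{8} \end{pmatrix}.$$ 2. The characteristic polynomial of $\overline{\mathfrak{A}}_\infty$ is $\chi(\lambda)=(\lambda-1)Q(\lambda)$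 with $$Q(\lambda)=\lambda^3+\frac{r^3-9r^2+171r-11}{64}\lambda^2+\frac{-11r^3+171r^2-9r+1}{64}\lambda+r^3.$$ 3. The polynomial $Q$ has a single real root $\lambda_0$, which satisfies $-1<-r<\lambda_0<-r^3<0$, and in addition two complex conjugated roots $\lambda_i^\pm$, which satisfy $0<|\lambda_0|<|\lambda_i^\pm|<1$. 4. In particular the spectrum of $\overline{\mathfrak{A}}_\infty$ consists of the four eigenvalues $1,\lambda_0,\lambda_i^+,\lambda_i^-$, all of geometric multiplicity $1$, and all except $1$ contained in the open unit disk of the complex plane. The eigenspace associated to the eigenvalue $1$ is $\mathrm{span}(0,1,0,1)$, written in the basis $(\omega_{1,\infty},0),(\omega_{1,\infty}^\perp,0),(0,\omega_{2,\infty}),(0,\omega_{2,\infty}^\perp)$ of $F$.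
   Context: Model. Three identical spherical particles $0,1,2$ of diameter $1$ in $\mathbb{R}^d$ ($d\ge2$), with positions $x_i$ and velocities $v_i$, evolve by the $r$-inelastic hard sphere flow, $r\in\,]0,1[$: free straight motion between collisions, and, when $|x_i-x_j|=1$, the velocities become $v_i'=v_i-\frac{1+r}{2}((v_i-v_j)\cdot\omega)\omega$, $v_j'=v_j+\frac{1+r}{2}((v_i-v_j)\cdot\omega)\omega$ with $\omega=(x_i-x_j)/|x_i-x_j|$. An inelastic collapse at time $\tau^*$ is an accumulation at $\tau^*$ (and nowhere before) of the increasing sequence $(t_n)$ of collision times; it is a triangular collapse if each of the three pairs collides infinitely many times. In a triangular collapse one may assume (up to relabelling) that from some index $n_0$ on the order of collisions is the infinite repetition of $0$-$1$, $0$-$2$, $1$-$2$, with the $(3n+n_0)$-th collisions of type $0$-$1$, the $(3n+1+n_0)$-th of type $0$-$2$ and the $(3n+2+n_0)$-th of type $1$-$2$. Let $\omega_{1,\infty},\omega_{2,\infty},\omega_{3,\infty}$ be the respective limits as $n\to\infty$ of $x_1-x_0$ at $t_{3n+n_0}$, $x_2-x_0$ at $t_{3n+1+n_0}$, $x_2-x_1$ at $t_{3n+2+n_0}$; they are unit vectors satisfying $\omega_{1,\infty}+\omega_{3,\infty}=\omega_{2,\infty}$ (so $\omega_{1,\infty}\cdot\omega_{2,\infty}=1/2$). Limiting velocity matrix (acting on $\mathbb{R}^d\times\mathbb{R}^d$, i.e. on pairs of relative velocities $(v_1-v_0,v_2-v_0)$): $\mathfrak{A}_\infty=A_{\mathfrak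 c}(\omega_{3,\infty})A_{\mathfrak b}(\omega_{2,\infty})A_{\mathfrak a}(\omega_{1,\infty})$, where, with $(u\otimes v)(x)=(u\cdot x)v$ and $I_d$ the identity, $$A_{\mathfrak a}(\omega)=\begin{pmatrix} I_d-(1+r)\omega\otimes\omega & 0\\ -\frac{1+r}{2}\omega\otimes\omega & I_d\end{pmatrix},\quad A_{\mathfrak b}(\omega)=\begin{pmatrix} I_d & -\frac{1+r}{2}\omega\otimes\omega\\ 0& I_d-(1+r)\omega\otimes\omega\end{pmatrix},$$ $$A_{\mathfrak c}(\omega)=\begin{pmatrix} I_d-\frac{1+r}{2}\omega\otimes\omega & \frac{1+r}{2}\omega\otimes\omega\\ \frac{1+r}{2}\omega\otimes\omega & I_d-\frac{1+r}{2}\omega\otimes\omega\end{pmatrix}.$$ $\omega_{1,\infty}^\perp$ (resp. $\omega_{2,\infty}^\perp$) is the unit vector of the plane $\mathrm{span}(\omega_{1,\infty},\omega_{2,\infty})$ orthogonal to $\omega_{1,\infty}$ (resp. $\omega_{2,\infty}$) such that $\omega_{1,\infty}^\perp\cdot\omega_{2,\infty}>0$ (resp. $\omega_{2,\infty}^\perp\cdot\omega_{1,\infty}<0$). *)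

theory Defs
  imports "HOL-Analysis.Analysis" "Jordan_Normal_Form.Spectral_Radius"
    "Jordan_Normal_Form.Matrix_Kernel"
begin

text \<open>
  Particles are numbered 0, 1, 2; \<open>x i s\<close> and \<open>v i s\<close> are the position and the velocity of
  particle \<open>i\<close> at time \<open>s\<close>. The inner product is written \<open>inner\<close>, since the dot notation
  is overloaded with the scalar product of \<open>Jordan_Normal_Form\<close>.
\<close>

definition contact :: "(nat \<Rightarrow> real \<Rightarrow> real ^ 'd) \<Rightarrow> nat \<Rightarrow> nat \<Rightarrow> real \<Rightarrow> bool" where
  "contact x i j s \<longleftrightarrow> norm (x i s - x j s) = 1"

definition collision_times :: "(nat \<Rightarrow> real \<Rightarrow> real ^ 'd) \<Rightarrow> real \<Rightarrow> real set" where
  "collision_times x T = {s. 0 < s \<and> s < T \<and> (\<exists>i j. i < j \<and> j < 3 \<and> contact x i j s)}"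

text \<open>
  The velocities are right-continuous, so that \<open>v i s\<close> at a collision time is the
  post-collisional velocity; the pre-collisional velocities \<open>w k\<close> are the left limits. A contact
  at the initial time is not counted as a collision: \<open>v i 0\<close> is the outgoing velocity. The law is
  imposed for every pair in contact, which excludes simultaneous non-grazing collisions.
\<close>

definition inelastic_flow ::
  "real \<Rightarrow> real \<Rightarrow> (nat \<Rightarrow> real \<Rightarrow> real ^ 'd) \<Rightarrow> (nat \<Rightarrow> real \<Rightarrow> real ^ 'd) \<Rightarrow> bool" where
  "inelastic_flow r T x v \<longleftrightarrow>
     0 < T \<and>
     (\<forall>s i j. 0 \<le> s \<and> s < T \<and> i < j \<and> j < 3 \<longrightarrow> 1 \<le> norm (x i s - x j s)) \<and>
     (\<forall>a b. 0 \<le> a \<and> a < b \<and> b < T \<and> {a<..<b} \<inter> collision_times x T = {} \<longrightarrow>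
        (\<forall>i<3. (\<forall>s\<in>{a..b}. x i s = x i a + (s - a) *\<^sub>R v i a) \<and>
                (\<forall>s\<in>{a..<b}. v i s = v i a))) \<and>
     (\<forall>s i j. 0 < s \<and> s < T \<and> i < j \<and> j < 3 \<and> contact x i j s \<longrightarrow>
        (\<exists>w. (\<forall>k<3. (v k \<longlongrightarrow> w k) (at_left s)) \<and>
             (let \<omega> = (x i s - x j s) /\<^sub>R norm (x i s - x j s);
                  c = (1 + r) / 2 * inner (w i - w j) \<omega>
              in v i s = w i - c *\<^sub>R \<omega> \<and> v j s = w j + c *\<^sub>R \<omega> \<and>
                 (\<forall>k<3. k \<noteq> i \<and> k \<noteq> j \<longrightarrow> v k s = w k))))"

text \<open>
  The sequence \<open>t\<close> lists all collision times in increasing order; as it converges to \<open>T\<close>, these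
  do not accumulate before \<open>T\<close>.
\<close>

definition inelastic_collapse ::
  "(nat \<Rightarrow> real \<Rightarrow> real ^ 'd) \<Rightarrow> real \<Rightarrow> (nat \<Rightarrow> real) \<Rightarrow> bool" where
  "inelastic_collapse x T t \<longleftrightarrow>
     strict_mono t \<and> range t = collision_times x T \<and> t \<longlonglongrightarrow> T"

definition triangular_collapse ::
  "(nat \<Rightarrow> real \<Rightarrow> real ^ 'd) \<Rightarrow> real \<Rightarrow> (nat \<Rightarrow> real) \<Rightarrow> bool" where
  "triangular_collapse x T t \<longleftrightarrow>
     inelastic_collapse x T t \<and>
     (\<forall>i j. i < j \<and> j < 3 \<longrightarrow> infinite {n. contact x i j (t n)})"

definition tensor :: "real ^ 'd \<Rightarrow> real ^ 'd \<Rightarrow> real ^ 'd \<Rightarrow> real ^ 'd" where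
  "tensor u w y = inner u y *\<^sub>R w"

definition block_map ::
  "(real ^ 'd \<Rightarrow> real ^ 'd) \<Rightarrow> (real ^ 'd \<Rightarrow> real ^ 'd) \<Rightarrow>
   (real ^ 'd \<Rightarrow> real ^ 'd) \<Rightarrow> (real ^ 'd \<Rightarrow> real ^ 'd) \<Rightarrow>
   (real ^ 'd) \<times> (real ^ 'd) \<Rightarrow> (real ^ 'd) \<times> (real ^ 'd)" where
  "block_map A B C D = (\<lambda>(y, z). (A y + B z, C y + D z))"

definition vel_a :: "real \<Rightarrow> real ^ 'd \<Rightarrow> (real ^ 'd) \<times> (real ^ 'd) \<Rightarrow> (real ^ 'd) \<times> (real ^ 'd)" where
  "vel_a r \<omega> = block_map
     (\<lambda>y. y - (1 + r) *\<^sub>R tensor \<omega> \<omega> y)           (\<lambda>z. 0)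
     (\<lambda>y. - ((1 + r) / 2) *\<^sub>R tensor \<omega> \<omega> y)       (\<lambda>z. z)"

definition vel_b :: "real \<Rightarrow> real ^ 'd \<Rightarrow> (real ^ 'd) \<times> (real ^ 'd) \<Rightarrow> (real ^ 'd) \<times> (real ^ 'd)" where
  "vel_b r \<omega> = block_map
     (\<lambda>y. y)    (\<lambda>z. - ((1 + r) / 2) *\<^sub>R tensor \<omega> \<omega> z)
     (\<lambda>y. 0)    (\<lambda>z. z - (1 + r) *\<^sub>R tensor \<omega> \<omega> z)"

definition vel_c :: "real \<Rightarrow> real ^ 'd \<Rightarrow> (real ^ 'd) \<times> (real ^ 'd) \<Rightarrow> (real ^ 'd) \<times> (real ^ 'd)" where
  "vel_c r \<omega> = block_map
     (\<lambda>y. y - ((1 + r) / 2) *\<^sub>R tensor \<omega> \<omega> y)    (\<lambda>z. ((1 + r) / 2) *\<^sub>R tensor \<omega> \<omega> z)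
     (\<lambda>y. ((1 + r) / 2) *\<^sub>R tensor \<omega> \<omega> y)        (\<lambda>z. z - ((1 + r) / 2) *\<^sub>R tensor \<omega> \<omega> z)"

definition limit_vel ::
  "real \<Rightarrow> real ^ 'd \<Rightarrow> real ^ 'd \<Rightarrow> real ^ 'd \<Rightarrow> (real ^ 'd) \<times> (real ^ 'd) \<Rightarrow> (real ^ 'd) \<times> (real ^ 'd)"
where
  "limit_vel r \<omega>1 \<omega>2 \<omega>3 = vel_c r \<omega>3 \<circ> vel_b r \<omega>2 \<circ> vel_a r \<omega>1"

definition is_basis_of :: "'a::real_vector list \<Rightarrow> 'a set \<Rightarrow> bool" where
  "is_basis_of bs F \<longleftrightarrow> distinct bs \<and> independent (set bs) \<and> span (set bs) = F"

text \<open>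
  The matrix, in the basis \<open>bs\<close>, of the restriction of \<open>f\<close> to \<open>span (set bs)\<close>: column \<open>j\<close> holds the
  coordinates of \<open>f (bs ! j)\<close>. It is meaningful only if \<open>bs\<close> is a basis of an \<open>f\<close>-invariant
  subspace, since \<open>representation\<close> is 0 outside of the span.
\<close>

definition restriction_mat :: "'a::real_vector list \<Rightarrow> ('a \<Rightarrow> 'a) \<Rightarrow> real mat" where
  "restriction_mat bs f =
     Matrix.mat (length bs) (length bs) (\<lambda>(i, j). representation (set bs) (f (bs ! j)) (bs ! i))"

definition geometric_multiplicity :: "'a::field mat \<Rightarrow> 'a \<Rightarrow> nat" where
  "geometric_multiplicity A k = kernel_dim (char_matrix A k)"

definition limit_mat :: "real \<Rightarrow> real mat" where
  "limit_mat r = mat_of_rows_list 4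
    [[(- (r^3) + 5*r^2 - 59*r - 1) / 64, sqrt 3 * (r + 1) / 8,
        (r^2 - 4*r - 5) / 16, - (sqrt 3 * (r + 1) / 8)],
     [sqrt 3 * (r^3 + 3*r^2 + 11*r + 9) / 64, (5 - 3*r) / 8,
        - (sqrt 3 * (r^2 + 4*r + 3) / 16), (3*r + 3) / 8],
     [(- (r^3) + 17*r^2 + 13*r - 5) / 64, sqrt 3 * (r + 1) / 8,
        (r^2 - 16*r - 1) / 16, - (sqrt 3 * (r + 1) / 8)],
     [sqrt 3 * (- (r^3) + r^2 + 13*r + 11) / 64, (3*r + 3) / 8,
        sqrt 3 * (r^2 - 1) / 16, (5 - 3*r) / 8]]"

definition Q_poly :: "real \<Rightarrow> real poly" where
  "Q_poly r = [: r^3, (- 11*r^3 + 171*r^2 - 9*r + 1) / 64, (r^3 - 9*r^2 + 171*r - 11) / 64, 1 :]"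

end

theory Submission
  imports Defs "Jordan_Normal_Form.Jordan_Normal_Form_Uniqueness"
begin

text \<open>
  Kinetic energy decreases along the flow, so velocities stay bounded and the displacement
  between consecutive collisions tends to 0. Hence the three limit directions are the edges of an
  equilateral triangle, and the matrix is a computation in the plane it spans.

  At the ends of \<open>[-r, -r\<^sup>3]\<close> the cubic \<open>Q\<close> takes the values \<open>r (r - 1) (r + 1)\<^sup>3 / 64 < 0\<close>
  and \<open>r\<^sup>3 (1 - r\<^sup>2) (63 (1 - r\<^sup>2)\<^sup>2 + 18 r\<^sup>2 + 9 r + 9 r\<^sup>3) / 64 > 0\<close>, and \<open>Q'\<close> has no real
  zero; so there is one real root \<open>l\<close>, and the bounds on the complex pair follow from
  \<open>l \<bar>z\<bar>\<^sup>2 = - r\<^sup>3\<close>. The eigenspace of 1 is found without solving a linear system: each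
  collision dissipates relative energy, so a fixed vector cannot be altered by any of the three factors.
\<close>

section \<open>Dissipation of kinetic energy and vanishing displacements\<close>

text \<open>The impulse is opposite on the two particles, so the change is a quadratic in
  \<open>c\<close>, and \<open>c = (1 + r) / 2 * d\<close> turns it into a loss of
  \<open>(1 - r\<^sup>2) / 2\<close> times the squared normal relative velocity.\<close>

lemma inelastic_law_energy_le:
  fixes a b \<omega> :: "'a::real_inner"
  assumes "0 \<le> r" "r \<le> 1" "norm \<omega> = 1"
  defines "c \<equiv> (1 + r) / 2 * inner (a - b) \<omega>"
  shows "(norm (a - c *\<^sub>R \<omega>))\<^sup>2 + (norm (b + c *\<^sub>R \<omega>))\<^sup>2 \<le> (norm a)\<^sup>2 + (norm b)\<^sup>2"
proof -
  define d where "d = inner (a - b) \<omega>"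
  have [simp]: "inner \<omega> \<omega> = 1"
    using assms(3) by (simp add: norm_eq_1)
  have c: "c = (1 + r) / 2 * d"
    by (simp add: c_def d_def)
  have "(norm (a - c *\<^sub>R \<omega>))\<^sup>2 + (norm (b + c *\<^sub>R \<omega>))\<^sup>2 = (norm a)\<^sup>2 + (norm b)\<^sup>2 - 2 * c * d + 2 * c\<^sup>2"
    unfolding power2_norm_eq_inner d_def by (simp add: inner_simps inner_commute algebra_simps power2_eq_square)
  also have "\<dots> = (norm a)\<^sup>2 + (norm b)\<^sup>2 - (1 + r) * (1 - r) / 2 * d\<^sup>2"
    by (simp add: c power2_eq_square field_simps)
  also have "\<dots> \<le> (norm a)\<^sup>2 + (norm b)\<^sup>2"
    using assms(1,2) by simp
  finally show ?thesis .
qed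

lemma inelastic_collapse_times:
  assumes "inelastic_collapse x T t"
  shows "0 < t n" "t n < T" "t n < t (Suc n)" "{t n<..<t (Suc n)} \<inter> collision_times x T = {}"
proof -
  have mono: "strict_mono t" and range: "range t = collision_times x T"
    using assms by (auto simp: inelastic_collapse_def)
  have "t n \<in> collision_times x T"
    using range by auto
  then show "0 < t n" "t n < T"
    by (auto simp: collision_times_def)
  show "t n < t (Suc n)"
    using mono by (simp add: strict_mono_Suc_iff)
  show "{t n<..<t (Suc n)} \<inter> collision_times x T = {}"
    unfolding range[symmetric] using strict_mono_less[OF mono] by auto
qed

lemma inelastic_flow_between_collisions:
  assumes "inelastic_flow r T x v" "inelastic_collapse x T t" "i < 3"
  shows "x i (t (Suc n)) = x i (t n) + (t (Suc n) - t n) *\<^sub>R v i (t n)"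
    and "\<And>s. t n \<le> s \<Longrightarrow> s < t (Suc n) \<Longrightarrow> v i s = v i (t n)"
proof -
  note tn = inelastic_collapse_times[OF assms(2)]
  have "\<forall>i<3. (\<forall>s\<in>{t n..t (Suc n)}. x i s = x i (t n) + (s - t n) *\<^sub>R v i (t n)) \<and>
                (\<forall>s\<in>{t n..<t (Suc n)}. v i s = v i (t n))"
    using assms(1) tn(1)[of n] tn(2)[of "Suc n"] tn(3,4)[of n] unfolding inelastic_flow_def
    by (meson less_imp_le)
  then have x: "\<forall>s\<in>{t n..t (Suc n)}. x i s = x i (t n) + (s - t n) *\<^sub>R v i (t n)"
    and v: "\<forall>s\<in>{t n..<t (Suc n)}. v i s = v i (t n)"
    using assms(3) by blast+
  show "x i (t (Suc n)) = x i (t n) + (t (Suc n) - t n) *\<^sub>R v i (t n)"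
    by (rule bspec[OF x]) (use tn(3)[of n] in simp)
  show "v i s = v i (t n)" if "t n \<le> s" "s < t (Suc n)" for s
    by (rule bspec[OF v]) (use that in simp)
qed

lemma inelastic_flow_collision:
  fixes x v :: "nat \<Rightarrow> real \<Rightarrow> real ^ 'd"
  assumes flow: "inelastic_flow r T x v" and "0 < s" "s < T" "i < j" "j < 3" "contact x i j s"
  defines "\<omega> \<equiv> (x i s - x j s) /\<^sub>R norm (x i s - x j s)"
  shows "\<exists>w. (\<forall>k<3. (v k \<longlongrightarrow> w k) (at_left s)) \<and>
    v i s = w i - ((1 + r) / 2 * inner (w i - w j) \<omega>) *\<^sub>R \<omega> \<and>
    v j s = w j + ((1 + r) / 2 * inner (w i - w j) \<omega>) *\<^sub>R \<omega> \<and>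
    (\<forall>k<3. k \<noteq> i \<and> k \<noteq> j \<longrightarrow> v k s = w k)"
proof -
  from flow have *: "\<forall>s i j. 0 < s \<and> s < T \<and> i < j \<and> j < 3 \<and> contact x i j s \<longrightarrow>
        (\<exists>w. (\<forall>k<3. (v k \<longlongrightarrow> w k) (at_left s)) \<and>
             (let \<omega> = (x i s - x j s) /\<^sub>R norm (x i s - x j s);
                  c = (1 + r) / 2 * inner (w i - w j) \<omega>
              in v i s = w i - c *\<^sub>R \<omega> \<and> v j s = w j + c *\<^sub>R \<omega> \<and>
                 (\<forall>k<3. k \<noteq> i \<and> k \<noteq> j \<longrightarrow> v k s = w k)))"
    unfolding inelastic_flow_def by (elim conjE)
  show ?thesis
    unfolding \<omega>_def
    by (rule *[THEN spec[of _ s], THEN spec[of _ i], THEN spec[of _ j], THEN mp, unfolded Let_def])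
      (use assms in simp)
qed

text \<open>Velocities do not change before \<open>t (Suc n)\<close>, so the left limits there are
  the velocities at \<open>t n\<close>, and one application of the collision law compares the two
  energies. Any pair in contact will do: the law for one pair prescribes all three outgoing
  velocities.\<close>

lemma kinetic_energy_antimono:
  assumes flow: "inelastic_flow r T x v" and coll: "inelastic_collapse x T t" and r: "0 \<le> r" "r \<le> 1"
  shows "(\<Sum>k<3. (norm (v k (t (Suc n))))\<^sup>2) \<le> (\<Sum>k<3. (norm (v k (t n)))\<^sup>2)"
proof -
  note tn = inelastic_collapse_times[OF coll]
  let ?s = "t (Suc n)"
  have "?s \<in> collision_times x T"
    using coll by (auto simp: inelastic_collapse_def)
  then obtain i j where ij: "i < j" "j < 3" "contact x i j ?s"
    by (auto simp: collision_times_def)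
  let ?\<omega> = "(x i ?s - x j ?s) /\<^sub>R norm (x i ?s - x j ?s)"
  obtain w where w: "(\<forall>k<3. (v k \<longlongrightarrow> w k) (at_left ?s)) \<and>
    v i ?s = w i - ((1 + r) / 2 * inner (w i - w j) ?\<omega>) *\<^sub>R ?\<omega> \<and>
    v j ?s = w j + ((1 + r) / 2 * inner (w i - w j) ?\<omega>) *\<^sub>R ?\<omega> \<and>
    (\<forall>k<3. k \<noteq> i \<and> k \<noteq> j \<longrightarrow> v k ?s = w k)"
    using inelastic_flow_collision[OF flow tn(1,2)[of "Suc n"] ij] by (rule exE)
  have w_eq: "w k = v k (t n)" if "k < 3" for k
  proof -
    have "\<forall>\<^sub>F s in at_left ?s. v k (t n) = v k s"
      unfolding eventually_at_left[OF tn(3)[of n]]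
    proof (intro exI conjI allI impI)
      show "t n < ?s"
        by (rule tn(3))
      fix s assume "t n < s" "s < ?s"
      then show "v k (t n) = v k s"
        using inelastic_flow_between_collisions(2)[OF flow coll that, of n s] by simp
    qed
    then have "(v k \<longlongrightarrow> v k (t n)) (at_left ?s)"
      using tendsto_eventually[of "v k" "v k (t n)" "at_left ?s"] by (simp add: eq_commute)
    then show ?thesis
      using w that tendsto_unique[OF trivial_limit_at_left_real] by blast
  qed
  have norm: "norm ?\<omega> = 1"
    using ij(3) by (simp add: contact_def)
  \<comment> \<open>The colliding pair is separated from the third particle, whose velocity is
    unchanged.\<close>
  have split: "(\<Sum>k<3. f k) = f i + f j + (\<Sum>k\<in>{..<3} - {i, j}. f k)" for f :: "nat \<Rightarrow> real"
  proof -
    have "{..<3} - {i} - {j} = {..<3} - {i, j}"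
      by auto
    then show ?thesis
      using ij sum.remove[of "{..<3}" i f] sum.remove[of "{..<3} - {i}" j f] by simp
  qed
  have rest: "(\<Sum>k\<in>{..<3} - {i, j}. (norm (v k ?s))\<^sup>2) = (\<Sum>k\<in>{..<3} - {i, j}. (norm (v k (t n)))\<^sup>2)"
    by (rule sum.cong) (use w w_eq in auto)
  show ?thesis
    unfolding split rest
    using inelastic_law_energy_le[OF r norm, of "w i" "w j"] w_eq[of i] w_eq[of j] w ij by simp
qed

text \<open>A displacement is a time step, which tends to 0 because \<open>t\<close> converges,
  times a velocity bounded by the energy at \<open>t 0\<close>.\<close>

lemma displacement_tendsto_0:
  assumes flow: "inelastic_flow r T x v" and coll: "inelastic_collapse x T t"
    and r: "0 \<le> r" "r \<le> 1" and i: "i < 3"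
  shows "(\<lambda>n. x i (t (Suc n)) - x i (t n)) \<longlonglongrightarrow> 0"
proof -
  define C where "C = (\<Sum>k<3. (norm (v k (t 0)))\<^sup>2)"
  have "decseq (\<lambda>n. \<Sum>k<3. (norm (v k (t n)))\<^sup>2)"
    using kinetic_energy_antimono[OF flow coll r] by (simp add: decseq_Suc_iff)
  then have "(\<Sum>k<3. (norm (v k (t n)))\<^sup>2) \<le> C" for n
    unfolding C_def by (auto dest: decseqD)
  moreover have "(norm (v i (t n)))\<^sup>2 \<le> (\<Sum>k<3. (norm (v k (t n)))\<^sup>2)" for n
    using i by (intro member_le_sum) auto
  ultimately have bound: "norm (v i (t n)) \<le> sqrt C" for n
    by (meson order_trans real_le_rsqrt)
  have "t \<longlonglongrightarrow> T"
    using coll by (simp add: inelastic_collapse_def)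
  then have "(\<lambda>n. t (Suc n) - t n) \<longlonglongrightarrow> 0"
    using tendsto_diff[OF LIMSEQ_Suc, of t T t T] by simp
  then have "(\<lambda>n. (t (Suc n) - t n) *\<^sub>R v i (t n)) \<longlonglongrightarrow> 0"
    by (intro lim_null_scaleR_bounded[where B = "sqrt C"]) (auto simp: bound)
  then show ?thesis
    using inelastic_flow_between_collisions(1)[OF flow coll i] by simp
qed

section \<open>The equilateral triangle of limit directions\<close>

text \<open>The three edges are observed at three different times, but as the displacements in
  between vanish, in the limit they belong to a single configuration, where they close up to a
  triangle.\<close>

lemma limit_directions:
  fixes x v :: "nat \<Rightarrow> real \<Rightarrow> real ^ 'd"
  assumes flow: "inelastic_flow r T x v" and coll: "inelastic_collapse x T t" and r: "0 \<le> r" "r \<le> 1"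
    and order: "\<And>n. contact x 0 1 (t (3 * n + n\<^sub>0))"
               "\<And>n. contact x 0 2 (t (3 * n + 1 + n\<^sub>0))"
               "\<And>n. contact x 1 2 (t (3 * n + 2 + n\<^sub>0))"
    and lim1: "(\<lambda>n. x 1 (t (3 * n + n\<^sub>0)) - x 0 (t (3 * n + n\<^sub>0))) \<longlonglongrightarrow> \<omega>1"
    and lim2: "(\<lambda>n. x 2 (t (3 * n + 1 + n\<^sub>0)) - x 0 (t (3 * n + 1 + n\<^sub>0))) \<longlonglongrightarrow> \<omega>2"
    and lim3: "(\<lambda>n. x 2 (t (3 * n + 2 + n\<^sub>0)) - x 1 (t (3 * n + 2 + n\<^sub>0))) \<longlonglongrightarrow> \<omega>3"
  shows "norm \<omega>1 = 1" "norm \<omega>2 = 1" "norm \<omega>3 = 1" "\<omega>1 + \<omega>3 = \<omega>2"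
proof -
  have unit: "norm w = 1" if "f \<longlonglongrightarrow> w" "\<And>n. norm (f n) = 1" for f :: "nat \<Rightarrow> real ^ 'd" and w
    using tendsto_norm[OF that(1)] that(2) by (simp add: LIMSEQ_const_iff)
  show "norm \<omega>1 = 1"
    by (rule unit[OF lim1]) (use order(1) in \<open>simp add: contact_def norm_minus_commute\<close>)
  show "norm \<omega>2 = 1"
    by (rule unit[OF lim2]) (use order(2) in \<open>simp add: contact_def norm_minus_commute\<close>)
  show "norm \<omega>3 = 1"
    by (rule unit[OF lim3]) (use order(3) in \<open>simp add: contact_def norm_minus_commute\<close>)
  have step: "(\<lambda>n. x i (t (Suc (3 * n + m))) - x i (t (3 * n + m))) \<longlonglongrightarrow> 0" if "i < 3" for i m
    by (rule LIMSEQ_subseq_LIMSEQ[OF displacement_tendsto_0[OF flow coll r that], 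
          of "\<lambda>n. 3 * n + m", unfolded o_def]) (simp add: strict_mono_def)
  define d where "d i m n = x i (t (Suc (3 * n + m))) - x i (t (3 * n + m))" for i m n
  have d: "d i m \<longlonglongrightarrow> 0" if "i < 3" for i m
    using step[OF that] by (simp add: d_def[abs_def])
  \<comment> \<open>Everything is transported to the middle collision: the \<open>d\<close> terms
    move the edge 0-1 one step forward and the edge 1-2 one step back.\<close>
  have "(\<lambda>n. (x 1 (t (3 * n + n\<^sub>0)) - x 0 (t (3 * n + n\<^sub>0))) + (d 1 n\<^sub>0 n - d 0 n\<^sub>0 n)
      + (x 2 (t (3 * n + 2 + n\<^sub>0)) - x 1 (t (3 * n + 2 + n\<^sub>0))) - (d 2 (Suc n\<^sub>0) n - d 1 (Suc n\<^sub>0) n))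
    \<longlonglongrightarrow> \<omega>1 + (0 - 0) + \<omega>3 - (0 - 0)"
    by (intro tendsto_intros lim1 lim3 d) auto
  also have "(\<lambda>n. (x 1 (t (3 * n + n\<^sub>0)) - x 0 (t (3 * n + n\<^sub>0))) + (d 1 n\<^sub>0 n - d 0 n\<^sub>0 n)
      + (x 2 (t (3 * n + 2 + n\<^sub>0)) - x 1 (t (3 * n + 2 + n\<^sub>0))) - (d 2 (Suc n\<^sub>0) n - d 1 (Suc n\<^sub>0) n))
    = (\<lambda>n. x 2 (t (3 * n + 1 + n\<^sub>0)) - x 0 (t (3 * n + 1 + n\<^sub>0)))"
    by (simp add: d_def)
  finally show "\<omega>1 + \<omega>3 = \<omega>2"
    using lim2 LIMSEQ_unique by fastforce
qed

text \<open>This makes the entries of \<open>restriction_mat\<close>, defined through the abstract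
  \<open>representation\<close>, computable as inner products.\<close>

lemma representation_orthonormal:
  fixes B :: "'a::euclidean_space set"
  assumes orth: "pairwise Linear_Algebra.orthogonal B" and unit: "\<And>b. b \<in> B \<Longrightarrow> norm b = 1"
    and v: "v \<in> span B" and b: "b \<in> B"
  shows "representation B v b = inner v b"
proof -
  have ind: "independent B"
    using orth unit by (intro pairwise_orthogonal_independent) force+
  then have "finite B"
    by (rule independent_bound[THEN conjunct1])
  have "v = (\<Sum>c\<in>B. representation B v c *\<^sub>R c)"
    using sum_representation_eq[OF ind v \<open>finite B\<close> subset_refl] by simp
  then have "inner v b = (\<Sum>c\<in>B. representation B v c * inner c b)"
    by (metis (no_types, lifting) inner_scaleR_left inner_sum_left sum.cong)
  also have "\<dots> = (\<Sum>c\<in>B. if c = b then representation B v b else 0)"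
  proof (rule sum.cong[OF refl])
    fix c assume "c \<in> B"
    then show "representation B v c * inner c b = (if c = b then representation B v b else 0)"
      using orth unit[OF b] b by (auto simp: pairwise_def Linear_Algebra.orthogonal_def norm_eq_1)
  qed
  finally show ?thesis
    using \<open>finite B\<close> b by simp
qed

section \<open>Relative energy and the fixed vectors of the limit map\<close>

text \<open>The (rescaled) kinetic energy of the velocities relative to the centre of mass, written in
  terms of \<open>(v\<^sub>1 - v\<^sub>0, v\<^sub>2 - v\<^sub>0)\<close>.\<close>

definition rel_energy :: "'a::real_inner \<times> 'a \<Rightarrow> real" where
  "rel_energy = (\<lambda>(y, z). inner y y + inner z z - inner y z)"

text \<open>The loss is governed by the relative velocity of the colliding pair:
  \<open>fst w\<close> for 0-1, and in the next two lemmas \<open>snd w\<close> for 0-2 and, up to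
  sign, \<open>fst w - snd w\<close> for 1-2. As \<open>rel_energy\<close> is 3/2 times the sum of
  the squared velocities relative to the centre of mass, the factor 3/4 is 3/2 times the 1/2 of the
  collision law.\<close>

lemma rel_energy_vel_a:
  assumes "norm \<omega> = 1"
  shows "rel_energy (vel_a r \<omega> w) = rel_energy w - 3 / 4 * (1 - r\<^sup>2) * (inner \<omega> (fst w))\<^sup>2"
proof -
  have "inner \<omega> \<omega> = 1"
    using assms by (simp add: norm_eq_1)
  then show ?thesis
    by (cases w) (simp add: rel_energy_def vel_a_def block_map_def tensor_def inner_simps inner_commute
        power2_eq_square field_simps)
qed

lemma rel_energy_vel_b:
  assumes "norm \<omega> = 1"
  shows "rel_energy (vel_b r \<omega> w) = rel_energy w - 3 / 4 * (1 - r\<^sup>2) * (inner \<omega> (snd w))\<^sup>2"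
proof -
  have "inner \<omega> \<omega> = 1"
    using assms by (simp add: norm_eq_1)
  then show ?thesis
    by (cases w) (simp add: rel_energy_def vel_b_def block_map_def tensor_def inner_simps inner_commute
        power2_eq_square field_simps)
qed

lemma rel_energy_vel_c:
  assumes "norm \<omega> = 1"
  shows "rel_energy (vel_c r \<omega> w) = rel_energy w - 3 / 4 * (1 - r\<^sup>2) * (inner \<omega> (fst w - snd w))\<^sup>2"
proof -
  have "inner \<omega> \<omega> = 1"
    using assms by (simp add: norm_eq_1)
  then show ?thesis
    by (cases w) (simp add: rel_energy_def vel_c_def block_map_def tensor_def inner_simps inner_commute
        power2_eq_square field_simps)
qed

text \<open>A fixed vector recovers its energy after three collisions, none of which can increase
  it, so every loss is 0. Conversely a factor acts as the identity when its normal relative velocity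
  vanishes.\<close>

lemma limit_vel_fixed_iff:
  assumes unit: "norm \<omega>1 = 1" "norm \<omega>2 = 1" "norm \<omega>3 = 1" and r: "\<bar>r\<bar> < 1"
  shows "limit_vel r \<omega>1 \<omega>2 \<omega>3 w = w \<longleftrightarrow>
    inner \<omega>1 (fst w) = 0 \<and> inner \<omega>2 (snd w) = 0 \<and> inner \<omega>3 (fst w - snd w) = 0"
    (is "?L \<longleftrightarrow> ?R")
proof
  assume fixed: ?L
  define w1 where "w1 = vel_a r \<omega>1 w"
  define w2 where "w2 = vel_b r \<omega>2 w1"
  have w3: "vel_c r \<omega>3 w2 = w"
    using fixed by (simp add: limit_vel_def w1_def w2_def)
  have pos: "0 < 3 / 4 * (1 - r\<^sup>2)"
    using r by (simp add: abs_square_less_1)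
  have "3 / 4 * (1 - r\<^sup>2) * ((inner \<omega>1 (fst w))\<^sup>2 + (inner \<omega>2 (snd w1))\<^sup>2 + (inner \<omega>3 (fst w2 - snd w2))\<^sup>2) = 0"
    using rel_energy_vel_a[OF unit(1), of r w] rel_energy_vel_b[OF unit(2), of r w1]
      rel_energy_vel_c[OF unit(3), of r w2] w3
    unfolding w1_def[symmetric] w2_def[symmetric] by (simp add: algebra_simps)
  then have "(inner \<omega>1 (fst w))\<^sup>2 + (inner \<omega>2 (snd w1))\<^sup>2 + (inner \<omega>3 (fst w2 - snd w2))\<^sup>2 = 0"
    using pos by (metis mult_eq_0_iff less_irrefl)
  then have k: "inner \<omega>1 (fst w) = 0" "inner \<omega>2 (snd w1) = 0" "inner \<omega>3 (fst w2 - snd w2) = 0"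
    by (smt (verit) zero_le_power2 power_eq_0_iff)+
  \<comment> \<open>The second and third losses concern the intermediate vectors \<open>w1\<close>
    and \<open>w2\<close>; these are identified with \<open>w\<close> one after the other.\<close>
  have "w1 = w"
    using k(1) by (cases w) (simp add: w1_def vel_a_def block_map_def tensor_def)
  moreover from this k(2) have "w2 = w"
    by (cases w) (simp add: w2_def vel_b_def block_map_def tensor_def)
  ultimately show ?R
    using k by simp
next
  assume ?R
  then show ?L
    by (cases w) (simp add: limit_vel_def vel_a_def vel_b_def vel_c_def block_map_def tensor_def inner_simps
        flip: scaleR_left.diff scaleR_left.add)
qed

section \<open>Coordinates in the plane of the triangle\<close>

text \<open>In the orthonormal frame \<open>\<omega>1\<close>, \<open>\<omega>1p\<close> the vectors
  \<open>\<omega>2\<close>, \<open>\<omega>3\<close>, \<open>\<omega>2p\<close> lie at 60, 120 and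
  150 degrees. Orthogonality and length fix each perpendicular up to sign, and the sign hypotheses
  choose one.\<close>

lemma plane_frame:
  fixes \<omega>1 \<omega>2 \<omega>3 \<omega>1p \<omega>2p :: "'a::real_inner"
  assumes unit: "norm \<omega>1 = 1" "norm \<omega>2 = 1" "norm \<omega>3 = 1" and add: "\<omega>1 + \<omega>3 = \<omega>2"
    and perp1: "\<omega>1p \<in> span {\<omega>1, \<omega>2}" "norm \<omega>1p = 1" "inner \<omega>1p \<omega>1 = 0" "inner \<omega>1p \<omega>2 > 0"
    and perp2: "\<omega>2p \<in> span {\<omega>1, \<omega>2}" "norm \<omega>2p = 1" "inner \<omega>2p \<omega>2 = 0" "inner \<omega>2p \<omega>1 < 0"
  shows "\<omega>2 = (1 / 2) *\<^sub>R \<omega>1 + (sqrt 3 / 2) *\<^sub>R \<omega>1p"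
    and "\<omega>3 = - (1 / 2) *\<^sub>R \<omega>1 + (sqrt 3 / 2) *\<^sub>R \<omega>1p"
    and "\<omega>2p = - (sqrt 3 / 2) *\<^sub>R \<omega>1 + (1 / 2) *\<^sub>R \<omega>1p"
proof -
  have n: "inner \<omega>1 \<omega>1 = 1" "inner \<omega>2 \<omega>2 = 1" "inner \<omega>3 \<omega>3 = 1" "inner \<omega>1p \<omega>1p = 1" "inner \<omega>2p \<omega>2p = 1"
    using unit perp1(2) perp2(2) by (simp_all add: norm_eq_1)
  have \<omega>3: "\<omega>3 = \<omega>2 - \<omega>1"
    using add by (simp add: algebra_simps)
  \<comment> \<open>Expanding the square of the unit vector
    \<open>\<omega>2 - \<omega>1\<close>.\<close>
  have ip: "inner \<omega>1 \<omega>2 = 1 / 2" "inner \<omega>2 \<omega>1 = 1 / 2"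
    using n(3) n(1,2) unfolding \<omega>3 by (simp_all add: inner_simps inner_commute)
  have span: "\<exists>a b. u = a *\<^sub>R \<omega>1 + b *\<^sub>R \<omega>2" if "u \<in> span {\<omega>1, \<omega>2}" for u
    using that by (auto simp: span_insert span_singleton algebra_simps intro: exI)
  have s: "sqrt 3 * sqrt 3 = (3::real)" "sqrt 3 > 0" "sqrt 3 * (sqrt 3 * y) = 3 * y" for y :: real
    by (simp_all flip: mult.assoc)
  \<comment> \<open>Used twice: with \<open>b\<close> for \<open>\<omega>1p\<close>, and with
    \<open>- c\<close> for \<open>\<omega>2p\<close>, whose sign condition makes \<open>c\<close>
    negative.\<close>
  have square: "b = 2 / sqrt 3" if "b\<^sup>2 * 3 / 4 = 1" "b > 0" for b :: real
  proof (rule power2_eq_imp_eq)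
    show "b\<^sup>2 = (2 / sqrt 3)\<^sup>2"
      using that(1) by (simp add: power_divide)
  qed (use that in auto)
  obtain a b where ab: "\<omega>1p = a *\<^sub>R \<omega>1 + b *\<^sub>R \<omega>2"
    using span[OF perp1(1)] by auto
  have a: "a = - b / 2"
    using perp1(3) by (simp add: ab inner_simps n ip)
  have "b * 3 / 4 > 0"
    using perp1(4) by (simp add: ab inner_simps n ip a)
  moreover have "b\<^sup>2 * 3 / 4 = 1"
    using n(4) by (simp add: ab inner_simps n ip a power2_eq_square)
  ultimately have b: "b = 2 / sqrt 3"
    by (intro square) auto
  have "\<omega>1p = (2 / sqrt 3) *\<^sub>R (\<omega>2 - (1 / 2) *\<^sub>R \<omega>1)"
    by (simp add: ab a b algebra_simps)
  then have "(sqrt 3 / 2) *\<^sub>R \<omega>1p = \<omega>2 - (1 / 2) *\<^sub>R \<omega>1"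
    by simp
  then show \<omega>2: "\<omega>2 = (1 / 2) *\<^sub>R \<omega>1 + (sqrt 3 / 2) *\<^sub>R \<omega>1p"
    by simp
  show "\<omega>3 = - (1 / 2) *\<^sub>R \<omega>1 + (sqrt 3 / 2) *\<^sub>R \<omega>1p"
    unfolding \<omega>3 by (subst \<omega>2) (simp add: algebra_simps flip: scaleR_left_distrib scaleR_2)
  obtain c d where cd: "\<omega>2p = c *\<^sub>R \<omega>1 + d *\<^sub>R \<omega>2"
    using span[OF perp2(1)] by auto
  have d: "d = - c / 2"
    using perp2(3) by (simp add: cd inner_simps n ip)
  have "- c * 3 / 4 > 0"
    using perp2(4) by (simp add: cd inner_simps n ip d)
  moreover have "(- c)\<^sup>2 * 3 / 4 = 1"
    using n(5) by (simp add: cd inner_simps n ip d power2_eq_square)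
  ultimately have "- c = 2 / sqrt 3"
    by (intro square) auto
  then have c: "c = - (2 / sqrt 3)"
    by simp
  have "\<omega>2p = (c + d / 2) *\<^sub>R \<omega>1 + (d * sqrt 3 / 2) *\<^sub>R \<omega>1p"
    unfolding cd by (subst \<omega>2) (simp add: algebra_simps)
  also have "c + d / 2 = - (sqrt 3 / 2)"
    using s by (simp add: c d field_simps)
  also have "d * sqrt 3 / 2 = 1 / 2"
    by (simp add: c d)
  finally show "\<omega>2p = - (sqrt 3 / 2) *\<^sub>R \<omega>1 + (1 / 2) *\<^sub>R \<omega>1p" .
qed

lemma limit_mat_carrier [simp]: "limit_mat r \<in> carrier_mat 4 4"
  unfolding carrier_mat_def limit_mat_def mat_of_rows_list_def by (simp add: numeral_eq_Suc)

text \<open>A named constant, so that calculations act on pairs of coordinates instead of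
  rearranging vector sums.\<close>

definition plane_vec :: "'a::real_vector \<Rightarrow> 'a \<Rightarrow> real \<Rightarrow> real \<Rightarrow> 'a" where
  "plane_vec e f a b = a *\<^sub>R e + b *\<^sub>R f"

lemma span_pair: "span {e, f} = {plane_vec e f a b |a b. True}"
  by (auto simp: span_insert span_singleton plane_vec_def algebra_simps)

lemma plane_vec_linear:
  "plane_vec e f a b + plane_vec e f c d = plane_vec e f (a + c) (b + d)"
  "plane_vec e f a b - plane_vec e f c d = plane_vec e f (a - c) (b - d)"
  "k *\<^sub>R plane_vec e f a b = plane_vec e f (k * a) (k * b)"
  by (simp_all add: plane_vec_def algebra_simps)

lemma inner_plane_vec:
  assumes "inner e e = 1" "inner f f = 1" "inner e f = 0"
  shows "inner (plane_vec e f a b) (plane_vec e f c d) = a * c + b * d"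
  using assms by (simp add: plane_vec_def inner_simps inner_commute)

text \<open>Rewrite rules that turn the three factors into arithmetic on four coordinates;
  \<open>k\<close> is the normal component of the relative velocity that the collision acts
  on.\<close>

lemma vel_plane_vec:
  fixes e f :: "real ^ 'd"
  assumes "inner e e = 1" "inner f f = 1" "inner e f = 0"
  defines "P \<equiv> plane_vec e f"
  shows "vel_a r (P p q) (P a b, P c d) =
      (let k = p * a + q * b in (P (a - (1 + r) * k * p) (b - (1 + r) * k * q),
        P (c - (1 + r) / 2 * k * p) (d - (1 + r) / 2 * k * q)))"
    and "vel_b r (P p q) (P a b, P c d) =
      (let k = p * c + q * d in (P (a - (1 + r) / 2 * k * p) (b - (1 + r) / 2 * k * q),
        P (c - (1 + r) * k * p) (d - (1 + r) * k * q)))"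
    and "vel_c r (P p q) (P a b, P c d) =
      (let k = p * (a - c) + q * (b - d) in (P (a - (1 + r) / 2 * k * p) (b - (1 + r) / 2 * k * q),
        P (c + (1 + r) / 2 * k * p) (d + (1 + r) / 2 * k * q)))"
proof -
  have "inner (P a b) (P c d) = a * c + b * d" for a b c d
    unfolding P_def by (rule inner_plane_vec) (fact assms)+
  note [simp] = this and [simp] = plane_vec_linear[where e = e and f = f, folded P_def]
  show "vel_a r (P p q) (P a b, P c d) =
      (let k = p * a + q * b in (P (a - (1 + r) * k * p) (b - (1 + r) * k * q),
        P (c - (1 + r) / 2 * k * p) (d - (1 + r) / 2 * k * q)))"
    by (simp add: vel_a_def block_map_def tensor_def Let_def mult.assoc)
  show "vel_b r (P p q) (P a b, P c d) =
      (let k = p * c + q * d in (P (a - (1 + r) / 2 * k * p) (b - (1 + r) / 2 * k * q),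
        P (c - (1 + r) * k * p) (d - (1 + r) * k * q)))"
    by (simp add: vel_b_def block_map_def tensor_def Let_def mult.assoc)
  show "vel_c r (P p q) (P a b, P c d) =
      (let k = p * (a - c) + q * (b - d) in (P (a - (1 + r) / 2 * k * p) (b - (1 + r) / 2 * k * q),
        P (c + (1 + r) / 2 * k * p) (d + (1 + r) / 2 * k * q)))"
    unfolding vel_c_def block_map_def tensor_def Let_def
    by simp (simp add: algebra_simps add_divide_distrib diff_divide_distrib)
qed

text \<open>Pairwise orthogonal nonzero vectors are independent. The two components have separate
  frames because the basis of the theorem uses \<open>\<omega>1\<close>, \<open>\<omega>1p\<close>
  in the first and \<open>\<omega>2\<close>, \<open>\<omega>2p\<close> in the second.\<close>

lemma is_basis_of_Times:
  fixes e f g h :: "'a::real_inner"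
  assumes "norm e = 1" "norm f = 1" "inner e f = 0" "norm g = 1" "norm h = 1" "inner g h = 0"
  shows "is_basis_of [(e, 0), (f, 0), (0, g), (0, h)] (span {e, f} \<times> span {g, h})"
    and "pairwise Linear_Algebra.orthogonal {(e, 0), (f, 0), (0, g), (0, h)}"
proof -
  let ?B = "{(e, 0), (f, 0), (0, g), (0, h)}"
  have ne: "e \<noteq> 0" "f \<noteq> 0" "g \<noteq> 0" "h \<noteq> 0" "e \<noteq> f" "g \<noteq> h"
    using assms by auto
  show orth: "pairwise Linear_Algebra.orthogonal ?B"
    using assms by (auto simp: pairwise_insert Linear_Algebra.orthogonal_def inner_commute)
  then have "independent ?B"
    using ne by (intro pairwise_orthogonal_independent) (auto simp: zero_prod_def)
  moreover have "span ?B = span {e, f} \<times> span {g, h}"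
  proof
    show "span ?B \<subseteq> span {e, f} \<times> span {g, h}"
      by (rule span_minimal) (auto intro: span_base span_zero subspace_Times)
    show "span {e, f} \<times> span {g, h} \<subseteq> span ?B"
    proof
      fix w assume "w \<in> span {e, f} \<times> span {g, h}"
      then obtain a b c d where "w = (plane_vec e f a b, plane_vec g h c d)"
        by (auto simp: span_pair)
      then have "w = a *\<^sub>R (e, 0) + b *\<^sub>R (f, 0) + c *\<^sub>R (0, g) + d *\<^sub>R (0, h)"
        by (simp add: plane_vec_def)
      moreover have "a *\<^sub>R (e, 0) + b *\<^sub>R (f, 0) + c *\<^sub>R (0, g) + d *\<^sub>R (0, h) \<in> span ?B"
        by (intro span_add span_scale span_base) auto
      ultimately show "w \<in> span ?B"
        by simp
    qed
  qed
  ultimately show "is_basis_of [(e, 0), (f, 0), (0, g), (0, h)] (span {e, f} \<times> span {g, h})"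
    using ne by (simp add: is_basis_of_def)
qed

text \<open>The basis is orthonormal, so each of the sixteen entries is an inner product, evaluated
  in coordinates.\<close>

lemma restriction_mat_limit_vel:
  fixes e f :: "real ^ 'd"
    and r :: real
  assumes on: "inner e e = 1" "inner f f = 1" "inner e f = 0"
  defines "P \<equiv> plane_vec e f"
  defines "bs \<equiv> [(P 1 0, 0), (P 0 1, 0), (0, P (1 / 2) (sqrt 3 / 2)), (0, P (- (sqrt 3 / 2)) (1 / 2))]"
    and "A \<equiv> limit_vel r (P 1 0) (P (1 / 2) (sqrt 3 / 2)) (P (- (1 / 2)) (sqrt 3 / 2))"
    and "F \<equiv> span {e, f} \<times> span {e, f}"
  shows "is_basis_of bs F" "A ` F \<subseteq> F" "restriction_mat bs A = limit_mat r"
proof -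
  have ip [simp]: "inner (P a b) (P c d) = a * c + b * d" for a b c d
    unfolding P_def by (rule inner_plane_vec) (fact on)+
  have P0: "P 0 0 = 0" and P_e: "P 1 0 = e" and P_f: "P 0 1 = f"
    by (simp_all add: P_def plane_vec_def)
  note vel [simp] = vel_plane_vec[OF on, folded P_def]
  have norm_P: "norm (P a b) = 1" if "a * a + b * b = 1" for a b
    using that by (simp add: norm_eq_1)
  let ?g = "P (1 / 2) (sqrt 3 / 2)" and ?h = "P (- (sqrt 3 / 2)) (1 / 2)"
  have span: "span {?g, ?h} = span {e, f}"
  proof
    show "span {?g, ?h} \<subseteq> span {e, f}"
      by (rule span_minimal[OF _ subspace_span]) (auto simp: span_pair P_def)
    show "span {e, f} \<subseteq> span {?g, ?h}"
    proof
      fix u assume "u \<in> span {e, f}"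
      then obtain a b where u: "u = P a b"
        by (auto simp: span_pair P_def)
      \<comment> \<open>The coefficients are the inner products of \<open>u\<close> with the
        orthonormal vectors \<open>?g\<close> and \<open>?h\<close>.\<close>
      have "u = (a / 2 + b * sqrt 3 / 2) *\<^sub>R ?g + (- (a * sqrt 3 / 2) + b / 2) *\<^sub>R ?h"
        unfolding u P_def plane_vec_linear
        by (rule arg_cong2[where f = "plane_vec e f"]) (simp_all add: field_simps)
      also have "\<dots> \<in> span {?g, ?h}"
        by (intro span_add span_scale span_base) auto
      finally show "u \<in> span {?g, ?h}" .
    qed
  qed
  note basis = is_basis_of_Times[of e f ?g ?h, unfolded span, folded F_def]
  have norms: "norm e = 1" "norm f = 1" "norm ?g = 1" "norm ?h = 1"
    using norm_P[of 1 0] norm_P[of 0 1] P_e P_f by (simp_all add: norm_P)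
  show is_basis: "is_basis_of bs F"
    using basis(1) norms on(3) unfolding bs_def P_e P_f by simp
  have orth: "pairwise Linear_Algebra.orthogonal (set bs)"
    using basis(2) norms on(3) unfolding bs_def P_e P_f by simp
  have P_F: "(P a b, P c d) \<in> F" for a b c d
    by (auto simp: F_def span_pair P_def)
  show invariant: "A ` F \<subseteq> F"
  proof (rule image_subsetI)
    fix w assume "w \<in> F"
    then obtain a b c d where "w = (P a b, P c d)"
      by (auto simp: F_def span_pair P_def)
    then show "A w \<in> F"
      by (simp add: A_def limit_vel_def Let_def P_F)
  qed
  have "restriction_mat bs A $$ (i, j) = inner (A (bs ! j)) (bs ! i)" if "i < 4" "j < 4" for i j
  proof -
    have len: "length bs = 4"
      by (simp add: bs_def)
    have "representation (set bs) (A (bs ! j)) (bs ! i) = inner (A (bs ! j)) (bs ! i)"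
    proof (rule representation_orthonormal[OF orth])
      show "norm b = 1" if "b \<in> set bs" for b
        using that norms unfolding bs_def P_e P_f by (auto simp: norm_Pair)
      have F: "span (set bs) = F"
        using is_basis by (simp add: is_basis_of_def)
      have "bs ! j \<in> F"
        using \<open>j < 4\<close> len by (auto simp flip: F intro: span_base)
      then show "A (bs ! j) \<in> span (set bs)"
        using invariant unfolding F by auto
      show "bs ! i \<in> set bs"
        using \<open>i < 4\<close> len by simp
    qed
    then show ?thesis
      using that len by (simp add: restriction_mat_def)
  qed
  moreover have "inner (A (bs ! j)) (bs ! i) = limit_mat r $$ (i, j)" if "i < 4" "j < 4" for i j
  proof -
    \<comment> \<open>Zero components are written as \<open>P 0 0\<close> so that the rules for
      \<open>P\<close> apply to them.\<close>
    have bs: "bs = [(P 1 0, P 0 0), (P 0 1, P 0 0), (P 0 0, ?g), (P 0 0, ?h)]"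
      by (simp add: bs_def P0)
    have sqrt3: "sqrt 3 * (sqrt 3 * y) = 3 * y" for y :: real
      by (simp flip: mult.assoc)
    have "i \<in> {0, 1, 2, 3}" "j \<in> {0, 1, 2, 3}"
      using that by auto
    then show ?thesis
      by (auto simp: bs A_def limit_vel_def Let_def limit_mat_def mat_of_rows_list_def
          power2_eq_square power3_eq_cube field_simps sqrt3)
  qed
  moreover have "restriction_mat bs A \<in> carrier_mat 4 4"
    unfolding restriction_mat_def carrier_mat_def by (simp add: bs_def numeral_eq_Suc)
  ultimately show "restriction_mat bs A = limit_mat r"
    using limit_mat_carrier[of r] by (intro eq_matI) (auto simp del: limit_mat_carrier)
qed

section \<open>The characteristic polynomial\<close>

lemma det_mat_3:
  fixes f :: "nat \<times> nat \<Rightarrow> 'a::comm_ring_1"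
  shows "Determinant.det (Matrix.mat 3 3 f) =
    f (0,0) * (f (1,1) * f (2,2) - f (1,2) * f (2,1))
    - f (0,1) * (f (1,0) * f (2,2) - f (1,2) * f (2,0))
    + f (0,2) * (f (1,0) * f (2,1) - f (1,1) * f (2,0))"
  by (simp add: laplace_expansion_row[of _ 3 0] laplace_expansion_row[of _ 2 0] numeral_nat cofactor_def
      mat_delete_def det_single algebra_simps)

text \<open>Expansion along row 0; \<open>D i j k\<close> is the minor on rows 1, 2, 3 and columns
  \<open>i\<close>, \<open>j\<close>, \<open>k\<close>.\<close>

lemma det_mat_4:
  fixes f :: "nat \<times> nat \<Rightarrow> 'a::comm_ring_1"
  defines "D \<equiv> \<lambda>i j k. f (1,i) * (f (2,j) * f (3,k) - f (2,k) * f (3,j))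
    - f (1,j) * (f (2,i) * f (3,k) - f (2,k) * f (3,i))
    + f (1,k) * (f (2,i) * f (3,j) - f (2,j) * f (3,i))"
  shows "Determinant.det (Matrix.mat 4 4 f) =
    f (0,0) * D 1 2 3 - f (0,1) * D 0 2 3 + f (0,2) * D 0 1 3 - f (0,3) * D 0 1 2"
proof -
  have "{..<4::nat} = {0, 1, 2, 3}"
    by auto
  moreover have "mat_delete (Matrix.mat 4 4 f) 0 j =
      Matrix.mat 3 3 (\<lambda>(i, k). f (Suc i, if k < j then k else Suc k))" for j
    by (rule eq_matI) (auto simp: mat_delete_def)
  \<comment> \<open>The three \<open>if\<close> terms list the columns that remain once column
    \<open>j\<close> is deleted.\<close>
  then have "Determinant.det (mat_delete (Matrix.mat 4 4 f) 0 j) =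
      D (if 0 < j then 0 else 1) (if 1 < j then 1 else 2) (if 2 < j then 2 else 3)" for j
    by (simp only: det_mat_3) (simp add: D_def numeral_2_eq_2 numeral_3_eq_3)
  ultimately show ?thesis
    by (simp add: laplace_expansion_row[of _ 4 0] cofactor_def)
qed

lemma char_poly_limit_mat: "char_poly (limit_mat r) = [:- 1, 1:] * Q_poly r"
proof (rule poly_eq_poly_eq_iff[THEN iffD1], rule ext)
  fix l
  \<comment> \<open>With \<open>sqrt 3\<close> opaque, what remains is a polynomial identity modulo
    \<open>s * s = 3\<close>.\<close>
  define s where "s = sqrt (3::real)"
  have s: "s * s = 3" "s * (s * y) = 3 * y" for y
    by (simp_all add: s_def flip: mult.assoc)
  have char_mat: "- char_matrix (limit_mat r) l =
      Matrix.mat 4 4 (\<lambda>(i, j). (if i = j then l else 0) - limit_mat r $$ (i, j))"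
    by (rule eq_matI) (auto simp: char_matrix_def limit_mat_def mat_of_rows_list_def)
  show "poly (char_poly (limit_mat r)) l = poly ([:- 1, 1:] * Q_poly r) l"
    unfolding char_poly_matrix[OF limit_mat_carrier] char_mat det_mat_4
    by (simp add: limit_mat_def mat_of_rows_list_def Q_poly_def s_def[symmetric])
      (simp add: field_simps s power2_eq_square power3_eq_cube)
qed

section \<open>Roots of the cubic and the spectrum\<close>

text \<open>The sizes of the Jordan blocks for \<open>z\<close> add up to its algebraic multiplicity
  1, so there is one block, and the dimension of the kernel counts the blocks.\<close>

lemma geometric_multiplicity_simple_root:
  fixes A :: "complex mat"
  assumes A: "A \<in> carrier_mat n n" and ord: "Polynomial.order z (char_poly A) = 1"
  shows "geometric_multiplicity A z = 1"
proof -
  obtain as where "char_poly A = (\<Prod>a\<leftarrow>as. [:- a, 1:])"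
    using char_poly_factorized[OF A] by auto
  then obtain n_as where jnf: "jordan_nf A n_as"
    using jordan_nf_exists[OF A] by blast
  define ns where "ns = map fst (filter (\<lambda>(n, e). e = z) n_as)"
  have "sum_list ns = 1"
    using jordan_nf_order[OF jnf, of z] ord by (simp add: ns_def case_prod_unfold)
  moreover have "0 \<notin> set ns"
    using jnf by (force simp: ns_def jordan_nf_def)
  ultimately have "ns = [1]"
    by (cases ns; cases "tl ns") auto
  moreover have "kernel_dim (char_matrix A z ^\<^sub>m 1) = sum_list (map (min 1) ns)"
    using dim_gen_eigenspace[OF jnf, of z 1] by (simp add: dim_gen_eigenspace_def ns_def)
  ultimately show ?thesis
    using A by (simp add: geometric_multiplicity_def)
qed

lemma order_simple_root:
  fixes q :: "'a::idom poly"
  assumes "poly q z \<noteq> 0"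
  shows "Polynomial.order z ([:- z, 1:] * q) = 1"
proof -
  have "q \<noteq> 0"
    using assms by auto
  then have "[:- z, 1:] * q \<noteq> 0"
    by (simp only: mult_eq_0_iff) simp
  then show ?thesis
    using assms order_linear_power[of z z 1] by (simp add: order_mult order_0I del: mult_pCons_left)
qed

text \<open>The condition on \<open>a\<close> and \<open>b\<close> says that the derivative has no
  real zero. Division by the linear factor of \<open>l\<close> leaves a quadratic with coefficients
  \<open>p\<close> and \<open>q\<close>; its roots are \<open>z\<close> and \<open>cnj z\<close>,
  and \<open>q\<close> is their product.\<close>

lemma cubic_one_real_root:
  fixes a b c l :: real
  assumes small: "a\<^sup>2 < 3 * b" and root: "poly [:c, b, a, 1:] l = 0"
  obtains z where "z \<notin> \<real>" "l * (cmod z)\<^sup>2 = - c"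
    "map_poly complex_of_real [:c, b, a, 1:] = [:- complex_of_real l, 1:] * [:- z, 1:] * [:- cnj z, 1:]"
proof -
  define p q where "p = a + l" and "q = b + a * l + l\<^sup>2"
  have c: "c = - l * q"
    using root by (simp add: q_def power2_eq_square algebra_simps)
  \<comment> \<open>The identity behind this is \<open>3 * (4 * q - p\<^sup>2) = 4 * (3 * b -
    a\<^sup>2) + (a + 3 * l)\<^sup>2\<close>.\<close>
  have "0 \<le> (a + 3 * l)\<^sup>2" by simp
  then have disc: "0 < 4 * q - p\<^sup>2"
    using small by (simp add: p_def q_def power2_eq_square algebra_simps)
  define z where "z = Complex (- p / 2) (sqrt (4 * q - p\<^sup>2) / 2)"
  have Im: "Im z > 0"
    using disc by (simp add: z_def)
  have norm: "(cmod z)\<^sup>2 = q"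
    using disc by (simp add: z_def cmod_power2 power_divide) (simp add: field_simps)
  have "complex_of_real p = - (z + cnj z)"
    by (simp add: z_def complex_eq_iff)
  moreover have "complex_of_real q = z * cnj z"
    using complex_norm_square[of z] norm by simp
  ultimately have "[:- z, 1:] * [:- cnj z, 1:] = [:complex_of_real q, complex_of_real p, 1:]"
    by simp
  moreover have "a = p - l" "b = q - l * p"
    by (simp_all add: p_def q_def power2_eq_square algebra_simps)
  then have "map_poly complex_of_real [:c, b, a, 1:] =
      [:- complex_of_real l, 1:] * [:complex_of_real q, complex_of_real p, 1:]"
    using c by (simp add: map_poly_pCons)
  ultimately have "map_poly complex_of_real [:c, b, a, 1:] =
      [:- complex_of_real l, 1:] * ([:- z, 1:] * [:- cnj z, 1:])"
    by simp
  moreover have "z \<notin> \<real>"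
    using Im complex_is_Real_iff by force
  ultimately show ?thesis
    using that[of z] norm c by (simp add: mult.assoc del: mult_pCons_left mult_pCons_right)
qed

lemma Q_poly_discriminant:
  fixes r :: real
  assumes "0 < r" "r < 1"
  shows "((r^3 - 9*r^2 + 171*r - 11) / 64)\<^sup>2 < 3 * ((- 11*r^3 + 171*r^2 - 9*r + 1) / 64)"
proof -
  have "r ^ 4 < r ^ 3" "r ^ 6 < r ^ 5" 
    using assms by (auto intro: power_strict_decreasing)
  moreover have "0 < r ^ 3" "0 < r ^ 2" "0 < r ^ 5" using assms by auto
  \<comment> \<open>The polynomial is \<open>64\<^sup>2\<close> times the difference of the two
    sides. Its negative terms are absorbed by those in \<open>r^3\<close> and
    \<open>r^5\<close>.\<close>
  ultimately have "0 < 71 + 2034 * r + 3393 * r^2 + 988 * r^3 - 423 * r^4 + 18 * r^5 - r^6"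
    using assms by linarith
  also have "\<dots> = 192 * (- 11*r^3 + 171*r^2 - 9*r + 1) - (r^3 - 9*r^2 + 171*r - 11)\<^sup>2"
    by (simp add: algebra_simps power_numeral_reduce)
  finally show ?thesis
    by (simp add: power_divide)
qed

lemma Q_poly_at_minus_r: "poly (Q_poly r) (- r) = r * (r - 1) * (r + 1)^3 / 64"
  by (simp add: Q_poly_def field_simps power_numeral_reduce)

lemma Q_poly_at_minus_r_cubed:
  "poly (Q_poly r) (- (r^3)) = r^3 * (1 - r\<^sup>2) * (63 * (1 - r\<^sup>2)\<^sup>2 + 18 * r\<^sup>2 + 9 * r + 9 * r^3) / 64"
  by (simp add: Q_poly_def field_simps power_numeral_reduce)

text \<open>The sign change between \<open>- r\<close> and \<open>- (r^3)\<close> locates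
  \<open>l\<close>. Since \<open>- l * (cmod z)\<^sup>2 = r^3\<close>, the upper bound on
  \<open>l\<close> keeps \<open>z\<close> inside the unit disk and the lower bound keeps it outside
  the circle through \<open>l\<close>.\<close>

lemma Q_poly_roots:
  assumes r: "0 < r" "r < 1"
  obtains l z where "- r < l" "l < - (r ^ 3)" "z \<notin> \<real>" "\<bar>l\<bar> < cmod z" "cmod z < 1"
    "map_poly complex_of_real (Q_poly r) = [:- complex_of_real l, 1:] * [:- z, 1:] * [:- cnj z, 1:]"
proof -
  have "r ^ 3 < r"
    using power_strict_decreasing[of 1 3 r] r by simp
  have "r\<^sup>2 < 1"
    using r by (simp add: power_less_one_iff)
  have neg: "poly (Q_poly r) (- r) < 0"
    unfolding Q_poly_at_minus_r using r by (simp add: mult_less_0_iff mult_pos_neg mult_neg_pos)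
  have pos: "0 < poly (Q_poly r) (- (r^3))"
    unfolding Q_poly_at_minus_r_cubed using r \<open>r\<^sup>2 < 1\<close>
    by (intro divide_pos_pos mult_pos_pos add_nonneg_pos) auto
  obtain l where l: "- r < l" "l < - (r^3)" "poly (Q_poly r) l = 0"
    using poly_IVT_pos[of "- r" "- (r^3)", OF _ neg pos] \<open>r ^ 3 < r\<close> by auto
  obtain z where z: "z \<notin> \<real>" "l * (cmod z)\<^sup>2 = - (r^3)"
    "map_poly complex_of_real (Q_poly r) = [:- complex_of_real l, 1:] * [:- z, 1:] * [:- cnj z, 1:]"
    using cubic_one_real_root[OF Q_poly_discriminant[OF r], of "r^3" l] l(3) unfolding Q_poly_def by metis
  have "0 < r^3" using r by simp
  then have "l < 0" using l by linarith
  have "(cmod z)\<^sup>2 < 1"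
  proof (rule ccontr)
    assume "\<not> ?thesis"
    then have "- l \<le> - l * (cmod z)\<^sup>2"
      using \<open>l < 0\<close> by simp
    then show False using z(2) l by simp
  qed
  then have 1: "cmod z < 1"
    by (simp add: power_less_one_iff)
  \<comment> \<open>Otherwise \<open>r^3 \<le> (- l)^3\<close>, against
    \<open>- l < r\<close>.\<close>
  have 2: "\<bar>l\<bar> < cmod z"
  proof (rule ccontr)
    assume "\<not> ?thesis"
    then have "(cmod z)\<^sup>2 \<le> l\<^sup>2" by (simp add: abs_le_square_iff[symmetric])
    then have "- l * (cmod z)\<^sup>2 \<le> - l * l\<^sup>2"
      using \<open>l < 0\<close> by (intro mult_left_mono) auto
    then have "r ^ 3 \<le> (- l) ^ 3"
      using z(2) by (simp add: power3_eq_cube power2_eq_square)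
    then show False
      using power_strict_mono[of "- l" r 3] l \<open>l < 0\<close> by simp
  qed
  show ?thesis
    using that l z 1 2 by blast
qed

text \<open>The four roots are distinct, hence simple, which gives geometric multiplicity 1 for
  each.\<close>

lemma spectrum_limit_mat:
  fixes r :: real
  assumes r: "0 < r" "r < 1"
  defines "Mc \<equiv> map_mat complex_of_real (limit_mat r)"
    and "Qc \<equiv> map_poly complex_of_real (Q_poly r)"
  obtains l z where "- r < l" "l < - (r ^ 3)" "{y. poly (Q_poly r) y = 0} = {l}"
    "{y. poly Qc y = 0} = {complex_of_real l, z, cnj z}" "z \<notin> \<real>" "\<bar>l\<bar> < cmod z" "cmod z < 1"
    "spectrum Mc = {1, complex_of_real l, z, cnj z}"
    "distinct [1, complex_of_real l, z, cnj z]"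
    "\<And>k. k \<in> spectrum Mc \<Longrightarrow> geometric_multiplicity Mc k = 1"
proof -
  obtain l z where l: "- r < l" "l < - (r ^ 3)" and z: "z \<notin> \<real>" "\<bar>l\<bar> < cmod z" "cmod z < 1"
    and Qc: "Qc = [:- complex_of_real l, 1:] * [:- z, 1:] * [:- cnj z, 1:]"
    unfolding Qc_def using Q_poly_roots[OF r] by metis
  have Qc_roots: "poly Qc y = 0 \<longleftrightarrow> y = complex_of_real l \<or> y = z \<or> y = cnj z" for y
    unfolding Qc poly_mult mult_eq_0_iff by auto
  have "poly (Q_poly r) y = 0 \<longleftrightarrow> y = l" for y
  proof -
    have "poly (Q_poly r) y = 0 \<longleftrightarrow> poly Qc (complex_of_real y) = 0"
      unfolding Qc_def by simp
    also have "\<dots> \<longleftrightarrow> y = l"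
      unfolding Qc_roots using z(1) by (metis Reals_cnj_iff Reals_of_real complex_cnj_cnj of_real_eq_iff)
    finally show ?thesis .
  qed
  then have real_roots: "{y. poly (Q_poly r) y = 0} = {l}"
    by auto
  have Mc: "Mc \<in> carrier_mat 4 4"
    by (simp add: Mc_def)
  interpret poly_hom: map_poly_comm_ring_hom complex_of_real ..
  have "char_poly Mc = map_poly complex_of_real ([:- 1, 1:] * Q_poly r)"
    unfolding Mc_def by (simp only: of_real_hom.char_poly_hom[OF limit_mat_carrier] char_poly_limit_mat)
  also have "\<dots> = [:- 1, 1:] * Qc"
    unfolding Qc_def poly_hom.hom_mult by (simp add: map_poly_pCons)
  finally have char: "char_poly Mc = [:- 1, 1:] * Qc" .
  have spec: "spectrum Mc = {1, complex_of_real l, z, cnj z}"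
    unfolding spectrum_root_char_poly[OF Mc] char poly_mult mult_eq_0_iff Qc_roots by auto
  have "0 < r ^ 3"
    using r by simp
  then have "l < 0"
    using l by linarith
  then have dist: "distinct [1, complex_of_real l, z, cnj z]"
    using z by (auto simp: complex_is_Real_iff complex_eq_iff)
  have "geometric_multiplicity Mc k = 1" if k: "k \<in> spectrum Mc" for k
  proof -
    \<comment> \<open>The factor of \<open>k\<close> is pulled to the front; the other three do not
      vanish at \<open>k\<close> because the roots are distinct.\<close>
    obtain q where q: "char_poly Mc = [:- k, 1:] * q" "poly q k \<noteq> 0"
    proof -
      consider "k = 1" | "k = complex_of_real l" | "k = z" | "k = cnj z"
        using k unfolding spec by blast
      then show thesis
      proof cases
        case 1
        show thesis
          by (rule that[of Qc]) (use dist 1 in \<open>auto simp: char Qc_roots\<close>)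
      next
        case 2
        show thesis
        proof (rule that)
          show "char_poly Mc = [:- k, 1:] * ([:- 1, 1:] * [:- z, 1:] * [:- cnj z, 1:])"
            unfolding char Qc 2 by (simp only: mult_ac)
          show "poly ([:- 1, 1:] * [:- z, 1:] * [:- cnj z, 1:]) k \<noteq> 0"
            unfolding poly_mult mult_eq_0_iff using dist 2 by auto
        qed
      next
        case 3
        show thesis
        proof (rule that)
          show "char_poly Mc = [:- k, 1:] * ([:- 1, 1:] * [:- complex_of_real l, 1:] * [:- cnj z, 1:])"
            unfolding char Qc 3 by (simp only: mult_ac)
          show "poly ([:- 1, 1:] * [:- complex_of_real l, 1:] * [:- cnj z, 1:]) k \<noteq> 0"
            unfolding poly_mult mult_eq_0_iff using dist 3 by auto
        qed
      next
        case 4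
        show thesis
        proof (rule that)
          show "char_poly Mc = [:- k, 1:] * ([:- 1, 1:] * [:- complex_of_real l, 1:] * [:- z, 1:])"
            unfolding char Qc 4 by (simp only: mult_ac)
          show "poly ([:- 1, 1:] * [:- complex_of_real l, 1:] * [:- z, 1:]) k \<noteq> 0"
            unfolding poly_mult mult_eq_0_iff using dist 4 by auto
        qed
      qed
    qed
    show ?thesis
      by (rule geometric_multiplicity_simple_root[OF Mc]) (simp only: q(1) order_simple_root[OF q(2)])
  qed
  then show thesis
    using that[of l z] l z real_roots Qc_roots spec dist by blast
qed

section \<open>The eigenspace of the eigenvalue 1\<close>

text \<open>Within the plane the three orthogonality conditions of
  \<open>limit_vel_fixed_iff\<close> are linear equations in four coordinates, and their solutions
  form a line.\<close>

lemma limit_vel_fixed_plane: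
  fixes e f :: "real ^ 'd"
    and r :: real
  assumes on: "inner e e = 1" "inner f f = 1" "inner e f = 0" and r: "\<bar>r\<bar> < 1"
  defines "P \<equiv> plane_vec e f"
  defines "A \<equiv> limit_vel r (P 1 0) (P (1 / 2) (sqrt 3 / 2)) (P (- (1 / 2)) (sqrt 3 / 2))"
    and "F \<equiv> span {e, f} \<times> span {e, f}"
  shows "{w \<in> F. A w = w} = span {(P 0 1, P (- (sqrt 3 / 2)) (1 / 2))}"
proof -
  have ip: "inner (P a b) (P c d) = a * c + b * d" for a b c d
    unfolding P_def by (rule inner_plane_vec) (fact on)+
  note lin = plane_vec_linear[where e = e and f = f, folded P_def]
  have fixed: "A (P a b, P c d) = (P a b, P c d) \<longleftrightarrow>
      a = 0 \<and> c + sqrt 3 * d = 0 \<and> c - a + sqrt 3 * (b - d) = 0" for a b c d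
    unfolding A_def
    by (subst limit_vel_fixed_iff) (use r in \<open>auto simp: norm_eq_1 ip lin field_simps\<close>)
  show ?thesis
  proof (intro subset_antisym subsetI)
    fix w assume "w \<in> {w \<in> F. A w = w}"
    then obtain a b c d where w: "w = (P a b, P c d)" and "A w = w"
      by (auto simp: F_def span_pair P_def)
    then have eqs: "a = 0" "c + sqrt 3 * d = 0" "c - a + sqrt 3 * (b - d) = 0"
      unfolding w fixed by auto
    \<comment> \<open>This combination of the equations eliminates \<open>a\<close> and
      \<open>c\<close>.\<close>
    have "sqrt 3 * (b - 2 * d) = (c - a + sqrt 3 * (b - d)) - (c + sqrt 3 * d) + a"
      by (simp add: algebra_simps)
    then have "b = 2 * d"
      unfolding eqs(2,3) by (simp add: eqs(1))
    moreover have "c = - (sqrt 3 * d)"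
      using eqs(2) by linarith
    ultimately have "w = (2 * d) *\<^sub>R (P 0 1, P (- (sqrt 3 / 2)) (1 / 2))"
      using eqs(1) by (simp add: w lin mult.commute)
    then show "w \<in> span {(P 0 1, P (- (sqrt 3 / 2)) (1 / 2))}"
      unfolding span_singleton by (rule range_eqI)
  next
    fix w assume "w \<in> span {(P 0 1, P (- (sqrt 3 / 2)) (1 / 2))}"
    then obtain k where "w = k *\<^sub>R (P 0 1, P (- (sqrt 3 / 2)) (1 / 2))"
      by (auto simp: span_singleton)
    then have w: "w = (P 0 k, P (- (sqrt 3 / 2) * k) (k / 2))"
      by (simp add: lin mult.commute)
    have "A w = w"
      unfolding w fixed by (simp add: field_simps)
    moreover have "w \<in> F"
      by (auto simp: w F_def span_pair P_def)
    ultimately show "w \<in> {w \<in> F. A w = w}"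
      by simp
  qed
qed

theorem theorem3:
  fixes r T :: real
    and x v :: "nat \<Rightarrow> real \<Rightarrow> real ^ 'd"
    and t :: "nat \<Rightarrow> real"
    and n\<^sub>0 :: nat
    and \<omega>1 \<omega>2 \<omega>3 \<omega>1p \<omega>2p :: "real ^ 'd"
  assumes dim: "CARD('d) \<ge> 2"
    and r: "0 < r" "r < 1"
    and flow: "inelastic_flow r T x v"
    and collapse: "triangular_collapse x T t"
    and order: "\<And>n. contact x 0 1 (t (3 * n + n\<^sub>0))"
               "\<And>n. contact x 0 2 (t (3 * n + 1 + n\<^sub>0))"
               "\<And>n. contact x 1 2 (t (3 * n + 2 + n\<^sub>0))"
    and lim1: "(\<lambda>n. x 1 (t (3 * n + n\<^sub>0)) - x 0 (t (3 * n + n\<^sub>0))) \<longlonglongrightarrow> \<omega>1"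
    and lim2: "(\<lambda>n. x 2 (t (3 * n + 1 + n\<^sub>0)) - x 0 (t (3 * n + 1 + n\<^sub>0))) \<longlonglongrightarrow> \<omega>2"
    and lim3: "(\<lambda>n. x 2 (t (3 * n + 2 + n\<^sub>0)) - x 1 (t (3 * n + 2 + n\<^sub>0))) \<longlonglongrightarrow> \<omega>3"
    and perp1: "\<omega>1p \<in> span {\<omega>1, \<omega>2}" "norm \<omega>1p = 1" "inner \<omega>1p \<omega>1 = 0" "inner \<omega>1p \<omega>2 > 0"
    and perp2: "\<omega>2p \<in> span {\<omega>1, \<omega>2}" "norm \<omega>2p = 1" "inner \<omega>2p \<omega>2 = 0" "inner \<omega>2p \<omega>1 < 0"
  shows
    "let F = span {\<omega>1, \<omega>2} \<times> span {\<omega>1, \<omega>2};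
         \<AA> = limit_vel r \<omega>1 \<omega>2 \<omega>3;
         bs = [(\<omega>1, 0), (\<omega>1p, 0), (0, \<omega>2), (0, \<omega>2p)];
         M = restriction_mat bs \<AA>;
         Mc = map_mat complex_of_real M;
         Qc = map_poly complex_of_real (Q_poly r)
     in
       \<AA> ` F \<subseteq> F \<and> is_basis_of bs F \<and> M = limit_mat r \<and>
       char_poly M = [:- 1, 1:] * Q_poly r \<and>
       (\<exists>l\<^sub>0 l\<^sub>p l\<^sub>m.
          {y. poly (Q_poly r) y = 0} = {l\<^sub>0} \<and>
          - 1 < - r \<and> - r < l\<^sub>0 \<and> l\<^sub>0 < - (r ^ 3) \<and> - (r ^ 3) < 0 \<and>
          {z. poly Qc z = 0} = {complex_of_real l\<^sub>0, l\<^sub>p, l\<^sub>m} \<and>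
          l\<^sub>p \<notin> \<real> \<and> l\<^sub>m = cnj l\<^sub>p \<and>
          0 < \<bar>l\<^sub>0\<bar> \<and>
          \<bar>l\<^sub>0\<bar> < cmod l\<^sub>p \<and> cmod l\<^sub>p < 1 \<and>
          \<bar>l\<^sub>0\<bar> < cmod l\<^sub>m \<and> cmod l\<^sub>m < 1 \<and>
          spectrum Mc = {1, complex_of_real l\<^sub>0, l\<^sub>p, l\<^sub>m} \<and>
          distinct [1, complex_of_real l\<^sub>0, l\<^sub>p, l\<^sub>m] \<and>
          (\<forall>z \<in> spectrum Mc. geometric_multiplicity Mc z = 1) \<and>
          (\<forall>z \<in> spectrum Mc - {1}. z \<in> ball 0 1)) \<and>
       {w \<in> F. \<AA> w = w} = span {(\<omega>1p, 0) + (0, \<omega>2p)}"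
proof -
  have inel: "inelastic_collapse x T t"
    using collapse by (simp add: triangular_collapse_def)
  note dir = limit_directions[OF flow inel less_imp_le[OF r(1)] less_imp_le[OF r(2)] order lim1 lim2 lim3]
  have on: "inner \<omega>1 \<omega>1 = 1" "inner \<omega>1p \<omega>1p = 1" "inner \<omega>1 \<omega>1p = 0"
    using dir(1) perp1(2,3) by (simp_all add: norm_eq_1 inner_commute)
  define P where "P = plane_vec \<omega>1 \<omega>1p"
  have P: "\<omega>1 = P 1 0" "\<omega>1p = P 0 1" "\<omega>2 = P (1 / 2) (sqrt 3 / 2)"
    "\<omega>3 = P (- (1 / 2)) (sqrt 3 / 2)" "\<omega>2p = P (- (sqrt 3 / 2)) (1 / 2)"
    using plane_frame[OF dir perp1 perp2] by (simp_all add: P_def plane_vec_def)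
  \<comment> \<open>\<open>F\<close> is spanned by the oblique pair \<open>\<omega>1\<close>,
    \<open>\<omega>2\<close>, while the coordinate lemmas require the orthonormal frame
    \<open>\<omega>1\<close>, \<open>\<omega>1p\<close>.\<close>
  have span: "span {\<omega>1, \<omega>2} = span {\<omega>1, \<omega>1p}"
  proof
    have "\<omega>2 \<in> span {\<omega>1, \<omega>1p}"
      unfolding P(3) P_def span_pair by auto
    then show "span {\<omega>1, \<omega>2} \<subseteq> span {\<omega>1, \<omega>1p}"
      by (intro span_minimal subspace_span) (auto intro: span_base)
    show "span {\<omega>1, \<omega>1p} \<subseteq> span {\<omega>1, \<omega>2}"
      using perp1(1) by (intro span_minimal subspace_span) (auto intro: span_base)
  qed
  define F where "F = span {\<omega>1, \<omega>2} \<times> span {\<omega>1, \<omega>2}"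
  define A where "A = limit_vel r \<omega>1 \<omega>2 \<omega>3"
  define bs where "bs = [(\<omega>1, 0), (\<omega>1p, 0), (0, \<omega>2), (0, \<omega>2p)]"
  have F: "F = span {\<omega>1, \<omega>1p} \<times> span {\<omega>1, \<omega>1p}"
    by (simp add: F_def span)
  have A: "A = limit_vel r (P 1 0) (P (1 / 2) (sqrt 3 / 2)) (P (- (1 / 2)) (sqrt 3 / 2))"
    using P by (simp add: A_def)
  have bs: "bs = [(P 1 0, 0), (P 0 1, 0), (0, P (1 / 2) (sqrt 3 / 2)), (0, P (- (sqrt 3 / 2)) (1 / 2))]"
    using P by (simp add: bs_def)
  have mat: "A ` F \<subseteq> F" "is_basis_of bs F" "restriction_mat bs A = limit_mat r"
    unfolding F A bs P_def by (rule restriction_mat_limit_vel[OF on])+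
  have "\<bar>r\<bar> < 1"
    using r by simp
  from limit_vel_fixed_plane[OF on this]
  \<comment> \<open>The generator \<open>(\<omega>1p, \<omega>2p)\<close> has coordinates (0, 1, 0,
    1) in \<open>bs\<close>.\<close>
  have fixed: "{w \<in> F. A w = w} = span {(\<omega>1p, 0) + (0, \<omega>2p)}"
    unfolding F A using P unfolding P_def by simp
  obtain l z where l: "- r < l" "l < - (r ^ 3)" and z: "z \<notin> \<real>" "\<bar>l\<bar> < cmod z" "cmod z < 1"
    and Q: "{y. poly (Q_poly r) y = 0} = {l}"
      "{y. poly (map_poly complex_of_real (Q_poly r)) y = 0} = {complex_of_real l, z, cnj z}"
    and spec: "spectrum (map_mat complex_of_real (limit_mat r)) = {1, complex_of_real l, z, cnj z}"
      "distinct [1, complex_of_real l, z, cnj z]"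
      "\<And>k. k \<in> spectrum (map_mat complex_of_real (limit_mat r)) \<Longrightarrow>
        geometric_multiplicity (map_mat complex_of_real (limit_mat r)) k = 1"
    using spectrum_limit_mat[OF r] by metis
  have "0 < r ^ 3"
    using r by simp
  then have "l < 0"
    using l by linarith
  have ball: "\<forall>k \<in> spectrum (map_mat complex_of_real (limit_mat r)) - {1}. k \<in> ball 0 1"
    unfolding spec(1) using z by auto
  have mult: "\<forall>k \<in> spectrum (map_mat complex_of_real (limit_mat r)).
      geometric_multiplicity (map_mat complex_of_real (limit_mat r)) k = 1"
    using spec(3) by blast
  show ?thesis
    unfolding Let_def F_def[symmetric] A_def[symmetric] bs_def[symmetric] mat(3)
    by (intro conjI mat(1,2) fixed refl char_poly_limit_mat,
        rule exI[of _ l], rule exI[of _ z], rule exI[of _ "cnj z"], intro conjI l z Q spec(1,2) mult ball refl)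
      (use r z \<open>l < 0\<close> \<open>0 < r ^ 3\<close> in simp_all)
qed

end
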